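(* Let $X$ be a generalized metric space. Then $\operatorname{Fix}_{LR}(X)$ is (categorically) complete. Moreover, for a diagram $J\colon D\to\operatorname{Fix}_{LR}(X)$ and a weighting $W\colon D\to[0,\infty]$, the limit is calculated by $$\lim\nolimits_W(J)=LR\bigl(\lim\nolimits_W(\iota\circ J)\bigr),$$ where $\iota\colon\operatorname{Fix}_{LR}(X)\to\check X^{\mathrm{op}}$ is the inclusion and the limit on the right is taken in $\check X^{\mathrm{op}}$.
   Context: A generalized metric space is a set $X$ with $d_X\colon X\times X\to[0,\infty]$ such that $d_X(x,x)=0$ and $d_X(x,y)+d_X(y,z)\ge d_X(x,z)$ for all $x,y,z\in X$ (no symmetry, separation or finiteness). For $a,b\in[0,\infty]$ write $b\dot{-}a:=\max(b-a,0)$ (with $\infty\dot{-}\infty=0$); $[0,\infty]$ is a generalized metric space with $d(a,b)=b\dot{-}a$. $X^{\mathrm{op}}$ has the same points and reversed metric. A short map $F\colon X\to Y$ is a function with $d_X(x,x')\ge d_Y(F(x),F(x'))$. $\widehat X$ is the space of presheaves, i.e. short maps $f\colon X^{\mathrm{op}}\to[0,\infty]$, with metric $\sup_x(f'(x)\dot{-}f(x))$; $\check X$ is the space of co-presheaves, i.e. short maps $g\colon X\to[0,\infty]$, with metric $d_{\check X}(g,g')=\sup_x(g'(x)\dot{-}g(x))$, and $\check X^{\mathrm{op}}$ is its opposite. Define $L\colon\widehat X\to\check X^{\mathrm{op}}$, $L(f)(y)=\sup_{x}(d_X(x,y)\dot{-}f(x))$, and $R\colon\check X^{\mathrm{op}}\to\widehat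 X$, $R(g)(x)=\sup_y(d_X(x,y)\dot{-}g(y))$. The composite $LR$ is idempotent. $\operatorname{Fix}_{LR}(X)=\{g\in\check X^{\mathrm{op}}\mid LR(g)=g\}$ with the metric induced from $\check X^{\mathrm{op}}$; $LR$ is regarded as a map $\check X^{\mathrm{op}}\to\operatorname{Fix}_{LR}(X)$. A shape is a generalized metric space $D$, a diagram in $Z$ is a short map $J\colon D\to Z$, a weighting (for limits) is a short map $W\colon D\to[0,\infty]$. A limit of $J$ weighted by $W$ is a point $l\in Z$ with $d_Z(z,l)=\sup_{e\in D}(d_Z(z,J(e))\dot{-}W(e))$ for all $z\in Z$, written $\lim_W(J)$; in $\check X^{\mathrm{op}}$ and $\operatorname{Fix}_{LR}(X)$ a limit is unique when it exists, and $\check X^{\mathrm{op}}$ has all limits. $Z$ is complete if limits exist for all shapes, diagrams and weightings. *)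

theory Defs
  imports "HOL-Analysis.Analysis"
begin

section \<open>Generalized metric spaces\<close>

record 'a gms =
  pts :: "'a set"
  gdist :: "'a \<Rightarrow> 'a \<Rightarrow> ennreal"

definition gen_metric_space :: "'a gms \<Rightarrow> bool" where
  "gen_metric_space X \<longleftrightarrow>
     (\<forall>x\<in>pts X. gdist X x x = 0) \<and>
     (\<forall>x\<in>pts X. \<forall>y\<in>pts X. \<forall>z\<in>pts X. gdist X x z \<le> gdist X x y + gdist X y z)"

text \<open>The subtraction of \<^typ>\<open>ennreal\<close> satisfies \<open>\<infinity> - \<infinity> = \<infinity>\<close>, whereas the truncated
  difference used here has \<open>\<infinity> \<ominus> \<infinity> = 0\<close>; hence the case distinction.\<close>

definition tdiff :: "ennreal \<Rightarrow> ennreal \<Rightarrow> ennreal"  (infixl "\<ominus>" 65) where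
  "b \<ominus> a = (if b \<le> a then 0 else b - a)"

definition ennreal_gms :: "ennreal gms" where
  "ennreal_gms = \<lparr>pts = UNIV, gdist = (\<lambda>a b. b \<ominus> a)\<rparr>"

definition opp :: "'a gms \<Rightarrow> 'a gms" where
  "opp X = \<lparr>pts = pts X, gdist = (\<lambda>x y. gdist X y x)\<rparr>"

definition short_map :: "'a gms \<Rightarrow> 'b gms \<Rightarrow> ('a \<Rightarrow> 'b) \<Rightarrow> bool" where
  "short_map X Y F \<longleftrightarrow>
     F \<in> pts X \<rightarrow> pts Y \<and>
     (\<forall>x\<in>pts X. \<forall>x'\<in>pts X. gdist Y (F x) (F x') \<le> gdist X x x')"

section \<open>Presheaves, co-presheaves and the fixed points of \<open>LR\<close>\<close>

text \<open>Functions on the set \<^term>\<open>pts X\<close> are represented by total functions that are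
  \<^const>\<open>undefined\<close> outside of it, so that equality of (co-)presheaves is pointwise equality
  on \<^term>\<open>pts X\<close>.\<close>

definition presheaves :: "'a gms \<Rightarrow> ('a \<Rightarrow> ennreal) gms" where
  "presheaves X =
     \<lparr>pts = {f \<in> extensional (pts X). short_map (opp X) ennreal_gms f},
      gdist = (\<lambda>f f'. SUP x\<in>pts X. f' x \<ominus> f x)\<rparr>"

definition copresheaves :: "'a gms \<Rightarrow> ('a \<Rightarrow> ennreal) gms" where
  "copresheaves X =
     \<lparr>pts = {g \<in> extensional (pts X). short_map X ennreal_gms g},
      gdist = (\<lambda>g g'. SUP x\<in>pts X. g' x \<ominus> g x)\<rparr>"

definition L_map :: "'a gms \<Rightarrow> ('a \<Rightarrow> ennreal) \<Rightarrow> ('a \<Rightarrow> ennreal)" where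
  "L_map X f = (\<lambda>y\<in>pts X. SUP x\<in>pts X. gdist X x y \<ominus> f x)"

definition R_map :: "'a gms \<Rightarrow> ('a \<Rightarrow> ennreal) \<Rightarrow> ('a \<Rightarrow> ennreal)" where
  "R_map X g = (\<lambda>x\<in>pts X. SUP y\<in>pts X. gdist X x y \<ominus> g y)"

definition LR :: "'a gms \<Rightarrow> ('a \<Rightarrow> ennreal) \<Rightarrow> ('a \<Rightarrow> ennreal)" where
  "LR X = L_map X \<circ> R_map X"

definition Fix_LR :: "'a gms \<Rightarrow> ('a \<Rightarrow> ennreal) gms" where
  "Fix_LR X =
     \<lparr>pts = {g \<in> pts (opp (copresheaves X)). LR X g = g},
      gdist = gdist (opp (copresheaves X))\<rparr>"

section \<open>Weighted limits\<close>

definition is_limit ::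
  "'z gms \<Rightarrow> 'd gms \<Rightarrow> ('d \<Rightarrow> 'z) \<Rightarrow> ('d \<Rightarrow> ennreal) \<Rightarrow> 'z \<Rightarrow> bool" where
  "is_limit Z D J W l \<longleftrightarrow>
     l \<in> pts Z \<and> (\<forall>z\<in>pts Z. gdist Z z l = (SUP e\<in>pts D. gdist Z z (J e) \<ominus> W e))"

text \<open>Meaningful only where limits exist uniquely; for the spaces at hand see
  \<open>is_limit_unique_copresheaves\<close>, \<open>is_limit_unique_Fix_LR\<close> and
  \<open>limits_exist_copresheaves\<close> below.\<close>

definition wlim :: "'z gms \<Rightarrow> 'd gms \<Rightarrow> ('d \<Rightarrow> 'z) \<Rightarrow> ('d \<Rightarrow> ennreal) \<Rightarrow> 'z" where
  "wlim Z D J W = (THE l. is_limit Z D J W l)"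

text \<open>The type argument is the type from which the points of the shapes are drawn; completeness
  with respect to all shapes is the statement for an arbitrary \<^typ>\<open>'d\<close>.\<close>

definition gms_complete :: "'d itself \<Rightarrow> 'z gms \<Rightarrow> bool" where
  "gms_complete _ Z \<longleftrightarrow>
     (\<forall>(D :: 'd gms) J W.
        gen_metric_space D \<longrightarrow> short_map D Z J \<longrightarrow> short_map D ennreal_gms W \<longrightarrow>
        (\<exists>l. is_limit Z D J W l))"

section \<open>Existence and uniqueness of limits\<close>

lemma tdiff_le_iff: "b \<ominus> a \<le> c \<longleftrightarrow> b \<le> a + c"
proof (cases "b \<le> a")
  case True
  then show ?thesis by (simp add: tdiff_def add_increasing2)
next
  case False
  then show ?thesis by (auto simp: tdiff_def ennreal_minus_le_iff top_unique)
qed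

lemma gdist_copresheaves_le_iff:
  "gdist (copresheaves X) g g' \<le> c \<longleftrightarrow> (\<forall>x\<in>pts X. g' x \<le> g x + c)"
  by (simp add: copresheaves_def SUP_le_iff tdiff_le_iff)

lemma copresheaf_eqI:
  assumes "g \<in> pts (copresheaves X)" "g' \<in> pts (copresheaves X)"
    and "gdist (copresheaves X) g g' = 0" "gdist (copresheaves X) g' g = 0"
  shows "g = g'"
proof (rule extensionalityI[of _ "pts X"])
  show "g \<in> extensional (pts X)" "g' \<in> extensional (pts X)"
    using assms(1,2) by (simp_all add: copresheaves_def)
  fix x assume "x \<in> pts X"
  then show "g x = g' x"
    using assms(3,4) gdist_copresheaves_le_iff[of X g g' 0]
      gdist_copresheaves_le_iff[of X g' g 0] by (auto intro: antisym)
qed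

lemma copresheaf_self: "gdist (copresheaves X) g g = 0"
  using gdist_copresheaves_le_iff[of X g g 0] by simp

lemma is_limit_unique_copresheaves:
  assumes "is_limit (opp (copresheaves X)) D J W l" "is_limit (opp (copresheaves X)) D J W l'"
  shows "l = l'"
  using assms by (intro copresheaf_eqI[of _ X]) (auto simp: is_limit_def opp_def copresheaf_self)

lemma is_limit_unique_Fix_LR:
  assumes "is_limit (Fix_LR X) D J W l" "is_limit (Fix_LR X) D J W l'"
  shows "l = l'"
  using assms by (intro copresheaf_eqI[of _ X])
    (auto simp: is_limit_def Fix_LR_def opp_def copresheaf_self)

lemma limits_exist_copresheaves:
  assumes J: "J \<in> pts D \<rightarrow> pts (opp (copresheaves X))"
  shows "\<exists>l. is_limit (opp (copresheaves X)) D J W l"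
proof
  define l where "l = (\<lambda>x\<in>pts X. INF e\<in>pts D. J e x + W e)"
  have INF_add: "(INF e\<in>pts D. f e) + c = (INF e\<in>pts D. f e + c)" for f and c :: ennreal
  proof -
    have "a \<le> (INF e\<in>pts D. f e) + c \<longleftrightarrow> a \<le> (INF e\<in>pts D. f e + c)" for a
      using tdiff_le_iff[of a c] by (simp add: le_INF_iff add.commute flip: tdiff_le_iff)
    then show ?thesis by (meson order.refl antisym)
  qed
  have l_add: "l x + c = (INF e\<in>pts D. J e x + W e + c)" if "x \<in> pts X" for x c
    using that by (simp add: l_def INF_add)
  have J_short: "J e y \<le> J e x + gdist X x y" if "e \<in> pts D" "x \<in> pts X" "y \<in> pts X" for e x y
    using J that by (auto simp: opp_def copresheaves_def short_map_def ennreal_gms_def tdiff_le_iff)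
  have "short_map X ennreal_gms l"
  proof -
    have "l y \<le> l x + gdist X x y" if xy: "x \<in> pts X" "y \<in> pts X" for x y
    proof -
      have "l y \<le> J e x + W e + gdist X x y" if e: "e \<in> pts D" for e
      proof -
        have "l y \<le> J e y + W e"
          using e xy by (auto simp: l_def intro: INF_lower)
        also have "\<dots> \<le> J e x + gdist X x y + W e"
          using J_short[OF e xy] by (rule add_right_mono)
        finally show ?thesis by (simp add: ac_simps)
      qed
      then show ?thesis by (simp add: l_add[OF xy(1)] le_INF_iff)
    qed
    then show ?thesis by (auto simp: short_map_def ennreal_gms_def tdiff_le_iff)
  qed
  then have "l \<in> pts (copresheaves X)"
    by (simp add: copresheaves_def l_def)
  moreover have "gdist (copresheaves X) l z = (SUP e\<in>pts D. gdist (copresheaves X) (J e) z \<ominus> W e)"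
    for z
  proof -
    have "gdist (copresheaves X) l z \<le> c \<longleftrightarrow>
        (SUP e\<in>pts D. gdist (copresheaves X) (J e) z \<ominus> W e) \<le> c" for c
    proof -
      have "z x \<le> l x + c \<longleftrightarrow> (\<forall>e\<in>pts D. z x \<le> J e x + (W e + c))" if "x \<in> pts X" for x
        by (simp add: l_add[OF that] le_INF_iff add.assoc)
      then show ?thesis
        by (auto simp: gdist_copresheaves_le_iff SUP_le_iff tdiff_le_iff)
    qed
    then show ?thesis by (meson order.refl antisym)
  qed
  ultimately show "is_limit (opp (copresheaves X)) D J W l"
    by (simp add: is_limit_def opp_def)
qed

section \<open>\<open>L\<close> and \<open>R\<close> are short maps between presheaves and opposite co-presheaves\<close>

lemma gdist_presheaves_le_iff:
  "gdist (presheaves X) f f' \<le> c \<longleftrightarrow> (\<forall>x\<in>pts X. f' x \<le> f x + c)"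
  by (simp add: presheaves_def SUP_le_iff tdiff_le_iff)

lemma L_map_le_iff: "y \<in> pts X \<Longrightarrow> L_map X f y \<le> c \<longleftrightarrow> (\<forall>x\<in>pts X. gdist X x y \<le> f x + c)"
  by (simp add: L_map_def SUP_le_iff tdiff_le_iff)

lemma R_map_le_iff: "x \<in> pts X \<Longrightarrow> R_map X g x \<le> c \<longleftrightarrow> (\<forall>y\<in>pts X. gdist X x y \<le> g y + c)"
  by (simp add: R_map_def SUP_le_iff tdiff_le_iff)

lemma gdist_le_L_map:
  "x \<in> pts X \<Longrightarrow> y \<in> pts X \<Longrightarrow> gdist X x y \<le> f x + L_map X f y"
  using L_map_le_iff[of y X f "L_map X f y"] by simp

lemma gdist_le_R_map:
  "x \<in> pts X \<Longrightarrow> y \<in> pts X \<Longrightarrow> gdist X x y \<le> g y + R_map X g x"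
  using R_map_le_iff[of x X g "R_map X g x"] by simp

lemma short_map_L_map:
  assumes X: "gen_metric_space X"
  shows "short_map (presheaves X) (opp (copresheaves X)) (L_map X)"
proof -
  have "L_map X f y' \<le> L_map X f y + gdist X y y'" if y: "y \<in> pts X" "y' \<in> pts X" for f y y'
    unfolding L_map_le_iff[OF y(2)]
  proof
    fix x assume x: "x \<in> pts X"
    have "gdist X x y' \<le> gdist X x y + gdist X y y'"
      using X x y by (simp add: gen_metric_space_def)
    also have "\<dots> \<le> f x + L_map X f y + gdist X y y'"
      using gdist_le_L_map[OF x y(1)] by (rule add_right_mono)
    finally show "gdist X x y' \<le> f x + (L_map X f y + gdist X y y')"
      by (simp add: add.assoc)
  qed
  then have "L_map X f \<in> pts (copresheaves X)" for f
    by (auto simp: copresheaves_def short_map_def ennreal_gms_def tdiff_le_iff L_map_def)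
  moreover have "gdist (copresheaves X) (L_map X f') (L_map X f) \<le> gdist (presheaves X) f f'"
    for f f'
    unfolding gdist_copresheaves_le_iff
  proof
    fix y assume y: "y \<in> pts X"
    let ?c = "gdist (presheaves X) f f'"
    show "L_map X f y \<le> L_map X f' y + ?c"
      unfolding L_map_le_iff[OF y]
    proof
      fix x assume x: "x \<in> pts X"
      have "gdist X x y \<le> f' x + L_map X f' y"
        by (rule gdist_le_L_map[OF x y])
      also have "\<dots> \<le> f x + ?c + L_map X f' y"
        using gdist_presheaves_le_iff[of X f f' ?c] x by (intro add_right_mono) simp
      finally show "gdist X x y \<le> f x + (L_map X f' y + ?c)"
        by (simp add: ac_simps)
    qed
  qed
  ultimately show ?thesis
    by (simp add: short_map_def opp_def)
qed

lemma short_map_R_map: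
  assumes X: "gen_metric_space X"
  shows "short_map (opp (copresheaves X)) (presheaves X) (R_map X)"
proof -
  have "R_map X g x' \<le> R_map X g x + gdist X x' x" if x: "x \<in> pts X" "x' \<in> pts X" for g x x'
    unfolding R_map_le_iff[OF x(2)]
  proof
    fix y assume y: "y \<in> pts X"
    have "gdist X x' y \<le> gdist X x' x + gdist X x y"
      using X x y by (simp add: gen_metric_space_def)
    also have "\<dots> \<le> gdist X x' x + (g y + R_map X g x)"
      using gdist_le_R_map[OF x(1) y] by (rule add_left_mono)
    finally show "gdist X x' y \<le> g y + (R_map X g x + gdist X x' x)"
      by (simp add: ac_simps)
  qed
  then have "R_map X g \<in> pts (presheaves X)" for g
    by (auto simp: presheaves_def short_map_def opp_def ennreal_gms_def tdiff_le_iff R_map_def)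
  moreover have "gdist (presheaves X) (R_map X g) (R_map X g') \<le> gdist (copresheaves X) g' g"
    for g g'
    unfolding gdist_presheaves_le_iff
  proof
    fix x assume x: "x \<in> pts X"
    let ?c = "gdist (copresheaves X) g' g"
    show "R_map X g' x \<le> R_map X g x + ?c"
      unfolding R_map_le_iff[OF x]
    proof
      fix y assume y: "y \<in> pts X"
      have "gdist X x y \<le> g y + R_map X g x"
        by (rule gdist_le_R_map[OF x y])
      also have "\<dots> \<le> g' y + ?c + R_map X g x"
        using gdist_copresheaves_le_iff[of X g' g ?c] y by (intro add_right_mono) simp
      finally show "gdist X x y \<le> g' y + (R_map X g x + ?c)"
        by (simp add: ac_simps)
    qed
  qed
  ultimately show ?thesis
    by (simp add: short_map_def opp_def)
qed

end

theory Submission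
  imports Defs
begin

text \<open>
  The fixed points of \<open>LR\<close> form a coreflective subspace of the opposite co-presheaves \<open>Z\<close>,
  and weighted limits in a coreflective subspace are obtained by coreflecting the ambient ones.

  The counit is the pointwise inequality \<open>LR g \<le> g\<close>, which in \<open>Z\<close> says that the distance from
  \<open>LR g\<close> to \<open>g\<close> is \<open>0\<close>; it is a rearrangement of the definition of \<open>R\<close>. If \<open>z\<close> is fixed, then
  shortness of \<open>LR\<close> gives that the distance from \<open>z = LR z\<close> to \<open>LR g\<close> is at most the one
  from \<open>z\<close> to \<open>g\<close>, and the counit gives the converse inequality. Hence a fixed point cannot
  distinguish \<open>g\<close> from \<open>LR g\<close> (\<open>gdist_copresheaves_LR_fixed\<close>). A weighted limit is characterised
  by the distances to it, so applying this to a limit \<open>l\<close> in \<open>Z\<close> of a diagram of fixed points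
  shows that \<open>LR l\<close>, which is itself fixed by idempotence, satisfies the limit equation against
  every fixed \<open>z\<close>. Completeness follows because \<open>Z\<close> has all weighted limits, and the formula
  follows because limits are unique in both spaces.
\<close>

text \<open>The counit and unit of the adjunction \<open>L \<stileturn> R\<close>. They hold because the inequalities
  \<open>d(x,y) \<le> g y + R g x\<close> and \<open>d(x,y) \<le> f x + L f y\<close> are symmetric in the function and its
  transform, so each can be read as a bound on the transform of the transform.\<close>

lemma L_R_le: "y \<in> pts X \<Longrightarrow> L_map X (R_map X g) y \<le> g y"
  by (simp add: L_map_le_iff gdist_le_R_map add.commute)

lemma R_L_le: "x \<in> pts X \<Longrightarrow> R_map X (L_map X f) x \<le> f x"
  by (simp add: R_map_le_iff gdist_le_L_map add.commute)

lemma short_map_comp: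
  "short_map X Y F \<Longrightarrow> short_map Y Z G \<Longrightarrow> short_map X Z (G \<circ> F)"
  unfolding short_map_def Pi_iff comp_apply by (meson order_trans)

lemma short_map_LR:
  assumes "gen_metric_space X"
  shows "short_map (opp (copresheaves X)) (opp (copresheaves X)) (LR X)"
  unfolding LR_def
  using short_map_R_map[OF assms] short_map_L_map[OF assms] by (rule short_map_comp)

lemma LR_in_copresheaves:
  assumes "gen_metric_space X" "g \<in> pts (copresheaves X)"
  shows "LR X g \<in> pts (copresheaves X)"
  using short_map_LR[OF assms(1)] assms(2) by (auto simp: short_map_def opp_def)

lemma gdist_copresheaves_LR_le:
  assumes "gen_metric_space X" "g \<in> pts (copresheaves X)" "g' \<in> pts (copresheaves X)"
  shows "gdist (copresheaves X) (LR X g) (LR X g') \<le> gdist (copresheaves X) g g'"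
  using short_map_LR[OF assms(1)] assms(2,3) by (auto simp: short_map_def opp_def)

lemma gdist_copresheaves_LR_counit: "gdist (copresheaves X) g (LR X g) = 0"
  using gdist_copresheaves_le_iff[of X g "LR X g" 0] by (simp add: LR_def L_R_le)

lemma gdist_copresheaves_triangle:
  "gdist (copresheaves X) f h \<le> gdist (copresheaves X) f g + gdist (copresheaves X) g h"
  unfolding gdist_copresheaves_le_iff
proof
  fix x assume x: "x \<in> pts X"
  have "h x \<le> g x + gdist (copresheaves X) g h"
    using x gdist_copresheaves_le_iff[of X g h "gdist (copresheaves X) g h"] by simp
  also have "\<dots> \<le> f x + gdist (copresheaves X) f g + gdist (copresheaves X) g h"
    using x gdist_copresheaves_le_iff[of X f g "gdist (copresheaves X) f g"]
    by (intro add_right_mono) simp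
  finally show "h x \<le> f x + (gdist (copresheaves X) f g + gdist (copresheaves X) g h)"
    by (simp add: add.assoc)
qed

text \<open>One inequality is the counit at \<open>LR g\<close>; the other is \<open>L\<close> applied to
  \<open>R L (R g) \<le> R g\<close>: being short into the opposite space, \<open>L\<close> reverses pointwise
  inequalities.\<close>

lemma LR_idem:
  assumes X: "gen_metric_space X" and g: "g \<in> pts (copresheaves X)"
  shows "LR X (LR X g) = LR X g"
proof (rule copresheaf_eqI[of _ X])
  show "LR X g \<in> pts (copresheaves X)" "LR X (LR X g) \<in> pts (copresheaves X)"
    using LR_in_copresheaves[OF X] g by blast+
  show "gdist (copresheaves X) (LR X g) (LR X (LR X g)) = 0"
    by (rule gdist_copresheaves_LR_counit)
  let ?f = "R_map X g" and ?f' = "R_map X (LR X g)"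
  have "?f \<in> pts (presheaves X)" "?f' \<in> pts (presheaves X)"
    using short_map_R_map[OF X] g LR_in_copresheaves[OF X g]
    by (auto simp: short_map_def opp_def)
  then have "gdist (copresheaves X) (L_map X ?f') (L_map X ?f) \<le> gdist (presheaves X) ?f ?f'"
    using short_map_L_map[OF X] by (simp add: short_map_def opp_def)
  moreover have "gdist (presheaves X) ?f ?f' \<le> 0"
    unfolding gdist_presheaves_le_iff by (simp add: LR_def R_L_le)
  ultimately show "gdist (copresheaves X) (LR X (LR X g)) (LR X g) = 0"
    by (simp add: LR_def)
qed

text \<open>This is the universal property of the coreflection: seen from a fixed point, \<open>LR g\<close> and
  \<open>g\<close> are at the same distance.\<close>

lemma gdist_copresheaves_LR_fixed:
  assumes X: "gen_metric_space X"
    and g: "g \<in> pts (copresheaves X)" and z: "z \<in> pts (copresheaves X)" "LR X z = z"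
  shows "gdist (copresheaves X) (LR X g) z = gdist (copresheaves X) g z"
proof (rule antisym)
  show "gdist (copresheaves X) (LR X g) z \<le> gdist (copresheaves X) g z"
    using gdist_copresheaves_LR_le[OF X g z(1)] z(2) by simp
  show "gdist (copresheaves X) g z \<le> gdist (copresheaves X) (LR X g) z"
    using gdist_copresheaves_triangle[of X g z "LR X g"]
    by (simp add: gdist_copresheaves_LR_counit)
qed

lemma is_limit_Fix_LR:
  assumes X: "gen_metric_space X"
    and l: "is_limit (opp (copresheaves X)) D J W l"
  shows "is_limit (Fix_LR X) D J W (LR X l)"
proof -
  have "l \<in> pts (copresheaves X)"
    using l by (simp add: is_limit_def opp_def)
  then show ?thesis
    using l LR_in_copresheaves[OF X] LR_idem[OF X] gdist_copresheaves_LR_fixed[OF X]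
    by (simp add: is_limit_def Fix_LR_def opp_def)
qed

theorem theorem19:
  fixes X :: "'a gms"
  assumes "gen_metric_space X"
  shows "gms_complete TYPE('d) (Fix_LR X) \<and>
    (\<forall>(D :: 'd gms) J W.
       gen_metric_space D \<longrightarrow> short_map D (Fix_LR X) J \<longrightarrow> short_map D ennreal_gms W \<longrightarrow>
       wlim (Fix_LR X) D J W = LR X (wlim (opp (copresheaves X)) D (id \<circ> J) W))"
proof -
  have ambient: "\<exists>l. is_limit (opp (copresheaves X)) D J W l"
    if "short_map D (Fix_LR X) J" for D :: "'d gms" and J W
    using that by (intro limits_exist_copresheaves) (auto simp: short_map_def Fix_LR_def)
  have "gms_complete TYPE('d) (Fix_LR X)"
    unfolding gms_complete_def using ambient is_limit_Fix_LR[OF assms] by blast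
  moreover have "wlim (Fix_LR X) D J W = LR X (wlim (opp (copresheaves X)) D (id \<circ> J) W)"
    if J: "short_map D (Fix_LR X) J" for D :: "'d gms" and J W
  proof -
    obtain l where l: "is_limit (opp (copresheaves X)) D J W l"
      using ambient[OF J] by blast
    have "wlim (opp (copresheaves X)) D J W = l"
      unfolding wlim_def
      using l is_limit_unique_copresheaves[OF _ l] by (rule the_equality)
    moreover have "wlim (Fix_LR X) D J W = LR X l"
      unfolding wlim_def
      using is_limit_Fix_LR[OF assms l] is_limit_unique_Fix_LR[OF _ is_limit_Fix_LR[OF assms l]]
      by (rule the_equality)
    ultimately show ?thesis by simp
  qed
  ultimately show ?thesis by blast
qed

end
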